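(* For state dependent data $q,F,G$ and any initial law $\mu\in\mathcal P_0(\mathbb S)$ at time $0$, the mean field games with state dependent relaxed controls and with path dependent relaxed controls have the same relaxed raw set value. That is, $$\{J(0,\mu,\gamma^*;\cdot,\gamma^* ):\gamma^*\in\mathcal A^{state}_{relax}\text{ is a state dependent relaxed MFE at }(0,\mu)\}=\{J(0,\mu,\gamma^*;\cdot,\gamma^* ):\gamma^*\in\mathcal A_{relax}\text{ is a relaxed MFE at }(0,\mu)\}$$ as sets of functions on $\mathbb S$.
   Context: $\mathbb T=\{0,\dots,T\}$; $\mathbb S$ finite with $|\mathbb S|=d$; $\mathcal P(\mathbb S)$: probability measures on $\mathbb S$ with $W_1(\mu,\nu):=\sum_{x}|\mu(x)-\nu(x)|$; $\mathcal P_0(\mathbb S)$: those with full support. $\mathbb A\subset\mathbb R^{d_0}$ measurable. State dependent data: $q:\mathbb T\times\mathbb S\times\mathcal P(\mathbb S)\times\mathbb A\times\mathbb S\to(0,1)$ with $\sum_{\tilde x}q(t,x,\mu,a;\tilde x)=1$, $F:\mathbb T\times\mathbb S\times\mathcal P(\mathbb S)\times\mathbb A\to\mathbb R$, $G:\mathbb S\times\mathcal P(\mathbb S)\to\mathbb R$. Standing assumption: (i) $q\ge c_q$ for a constant $c_q>0$; (ii) $q$ is Lipschitz continuous in $(\mu,a)$ with constant $L_q$; (iii) $F,G$ are bounded by $C_0$ and uniformly continuous in $(\mu,a)$ with modulus $\rho$. $\mathbb X=\mathbb S^{T+1}$ with canonical process $X$; $\mathbf x_{t\wedge\cdot}$ is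 the path $\mathbf x$ stopped at $t$; $X=_s\mathbf x$ means $X$ and $\mathbf x$ agree up to time $s$. $\mathcal A_{relax}$: path dependent adapted relaxed controls $\gamma:\mathbb T\times\mathbb X\to\mathcal P(\mathbb A)$, $\gamma(t,\mathbf x;da)=\gamma(t,\mathbf x_{t\wedge\cdot};da)$. $\mathcal A^{state}_{relax}\subset\mathcal A_{relax}$: those of the form $\gamma(t,\mathbf x_t,da)$. For $\gamma\in\mathcal A_{relax}$: the law $\mathbb P^{0,\mu,\gamma}$ has $X_0\sim\mu$ and $\mathbb P^{0,\mu,\gamma}(X_{s+1}=\tilde x|X=_s\mathbf x)=\int_{\mathbb A}q(s,\mathbf x_s,\mu^\gamma_s,a;\tilde x)\gamma(s,\mathbf x;da)$, where $\mu^\gamma_s$ is the law of $X_s$. For $x\in\mathbb S$ and $\tilde\gamma\in\mathcal A_{relax}$, $\mathbb P^{\mu^\gamma;0,x,\tilde\gamma}$ has $X_0=x$ and transition $\int_{\mathbb A}q(s,\mathbf x_s,\mu^\gamma_s,a;\cdot)\tilde\gamma(s,\mathbf x;da)$; $J(0,\mu,\gamma;x,\tilde\gamma):=\mathbb E^{\mathbb P^{\mu^\gamma;0,x,\tilde\gamma}}[G(X_T,\mu^\gamma_T)+\sum_{s=0}^{T-1}\int_{\mathbb A}F(s,X_s,\mu^\gamma_s,a)\tilde\gamma(s,X;da)]$. $\gamma^*\in\mathcal A_{relax}$ is a relaxed MFE at $(0,\mu)$ if $J(0,\mu,\gamma^*;x,\gamma^* )=\inf_{\gamma\in\mathcal A_{relax}}J(0,\mu,\gamma^*;x,\gamma)$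 for all $x\in\mathbb S$. $\gamma^*\in\mathcal A^{state}_{relax}$ is a state dependent relaxed MFE at $(0,\mu)$ if $J(0,\mu,\gamma^*;x,\gamma^* )=\inf_{\gamma\in\mathcal A^{state}_{relax}}J(0,\mu,\gamma^*;x,\gamma)$ for all $x\in\mathbb S$. The relaxed raw set value is the set of functions $J(0,\mu,\gamma^*;\cdot,\gamma^* )$ over all (exact) equilibria of the respective type. *)

theory Defs
  imports "HOL-Probability.Probability"
begin

text \<open>
  The finite state space is a type \<open>'s::finite\<close>, measures on it are \<open>'s pmf\<close>, and the actions
  form a Borel set \<open>A\<close> of vectors.
\<close>

definition W1 :: "'s::finite pmf \<Rightarrow> 's pmf \<Rightarrow> real" where
  "W1 \<mu> \<nu> = (\<Sum>x\<in>UNIV. \<bar>pmf \<mu> x - pmf \<nu> x\<bar>)"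

definition full_support :: "'s pmf set" where
  "full_support = {\<mu>. set_pmf \<mu> = UNIV}"

definition paths :: "nat \<Rightarrow> (nat \<Rightarrow> 's) set" where
  "paths T = {..T} \<rightarrow>\<^sub>E UNIV"

definition stop :: "nat \<Rightarrow> nat \<Rightarrow> (nat \<Rightarrow> 's) \<Rightarrow> nat \<Rightarrow> 's" where
  "stop T t x = (\<lambda>r\<in>{..T}. x (min r t))"

definition agree :: "nat \<Rightarrow> (nat \<Rightarrow> 's) \<Rightarrow> (nat \<Rightarrow> 's) set" where
  "agree s x = {X. \<forall>r\<le>s. X r = x r}"

definition relaxed_actions :: "'a::topological_space set \<Rightarrow> 'a measure set" where
  "relaxed_actions A = space (prob_algebra (restrict_space borel A))"

definition relax_controls ::
    "nat \<Rightarrow> 'a::topological_space set \<Rightarrow> (nat \<Rightarrow> (nat \<Rightarrow> 's) \<Rightarrow> 'a measure) set" where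
  "relax_controls T A = {\<gamma>. \<forall>t\<le>T. \<forall>x\<in>paths T.
     \<gamma> t x \<in> relaxed_actions A \<and> \<gamma> t x = \<gamma> t (stop T t x)}"

definition state_relax_controls ::
    "nat \<Rightarrow> 'a::topological_space set \<Rightarrow> (nat \<Rightarrow> (nat \<Rightarrow> 's) \<Rightarrow> 'a measure) set" where
  "state_relax_controls T A =
     {\<gamma> \<in> relax_controls T A. \<exists>\<eta>. \<forall>t\<le>T. \<forall>x\<in>paths T. \<gamma> t x = \<eta> t (x t)}"

definition trans_pmf ::
    "(nat \<Rightarrow> 's \<Rightarrow> 's pmf \<Rightarrow> 'a \<Rightarrow> 's \<Rightarrow> real) \<Rightarrow> nat \<Rightarrow> 's \<Rightarrow> 's pmf \<Rightarrow> 'a measure \<Rightarrow> 's pmf" where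
  "trans_pmf q s x \<nu> \<eta> = embed_pmf (\<lambda>y. LINT a|\<eta>. q s x \<nu> a y)"

text \<open>
  One time step: if \<open>P\<close> is the law of the canonical process stopped at \<open>s\<close>, then
  \<open>step T q \<gamma> \<nu> s P\<close> is its law stopped at \<open>Suc s\<close>, where \<open>\<nu>\<close> is the population measure at \<open>s\<close>.
\<close>

definition step ::
    "nat \<Rightarrow> (nat \<Rightarrow> 's \<Rightarrow> 's pmf \<Rightarrow> 'a \<Rightarrow> 's \<Rightarrow> real) \<Rightarrow> (nat \<Rightarrow> (nat \<Rightarrow> 's) \<Rightarrow> 'a measure)
      \<Rightarrow> 's pmf \<Rightarrow> nat \<Rightarrow> (nat \<Rightarrow> 's) pmf \<Rightarrow> (nat \<Rightarrow> 's) pmf" where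
  "step T q \<gamma> \<nu> s P =
     bind_pmf P (\<lambda>X. map_pmf (\<lambda>y. stop T (Suc s) (X(Suc s := y))) (trans_pmf q s (X s) \<nu> (\<gamma> s X)))"

text \<open>
  \<open>path_law T q \<nu> \<mu> \<gamma> s\<close> is the law of the process stopped at \<open>s\<close> with initial law \<open>\<mu>\<close> and control
  \<open>\<gamma>\<close> when the flow of population measures \<open>\<nu>\<close> is given. In \<open>mf_path_law\<close> the population
  measure is the current marginal of the law itself. Laws on the whole path space are the case
  \<open>s = T\<close>; \<open>path_law_cond\<close> and \<open>mf_path_law_cond\<close> below show that they have the transition
  probabilities prescribed for them.
\<close>

primrec path_law ::
    "nat \<Rightarrow> (nat \<Rightarrow> 's \<Rightarrow> 's pmf \<Rightarrow> 'a \<Rightarrow> 's \<Rightarrow> real) \<Rightarrow> (nat \<Rightarrow> 's pmf) \<Rightarrow> 's pmf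
      \<Rightarrow> (nat \<Rightarrow> (nat \<Rightarrow> 's) \<Rightarrow> 'a measure) \<Rightarrow> nat \<Rightarrow> (nat \<Rightarrow> 's) pmf" where
  "path_law T q \<nu> \<mu> \<gamma> 0 = map_pmf (\<lambda>x. stop T 0 (\<lambda>_. x)) \<mu>"
| "path_law T q \<nu> \<mu> \<gamma> (Suc s) = step T q \<gamma> (\<nu> s) s (path_law T q \<nu> \<mu> \<gamma> s)"

primrec mf_path_law ::
    "nat \<Rightarrow> (nat \<Rightarrow> 's \<Rightarrow> 's pmf \<Rightarrow> 'a \<Rightarrow> 's \<Rightarrow> real) \<Rightarrow> 's pmf
      \<Rightarrow> (nat \<Rightarrow> (nat \<Rightarrow> 's) \<Rightarrow> 'a measure) \<Rightarrow> nat \<Rightarrow> (nat \<Rightarrow> 's) pmf" where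
  "mf_path_law T q \<mu> \<gamma> 0 = map_pmf (\<lambda>x. stop T 0 (\<lambda>_. x)) \<mu>"
| "mf_path_law T q \<mu> \<gamma> (Suc s) =
     step T q \<gamma> (map_pmf (\<lambda>X. X s) (mf_path_law T q \<mu> \<gamma> s)) s (mf_path_law T q \<mu> \<gamma> s)"

definition flow ::
    "nat \<Rightarrow> (nat \<Rightarrow> 's \<Rightarrow> 's pmf \<Rightarrow> 'a \<Rightarrow> 's \<Rightarrow> real) \<Rightarrow> 's pmf
      \<Rightarrow> (nat \<Rightarrow> (nat \<Rightarrow> 's) \<Rightarrow> 'a measure) \<Rightarrow> nat \<Rightarrow> 's pmf" where
  "flow T q \<mu> \<gamma> s = map_pmf (\<lambda>X. X s) (mf_path_law T q \<mu> \<gamma> T)"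

text \<open>\<open>J T q F G \<mu> \<gamma> x \<gamma>'\<close>: the population uses \<open>\<gamma>\<close>, the player starts at \<open>x\<close> and uses \<open>\<gamma>'\<close>.\<close>

definition J ::
    "nat \<Rightarrow> (nat \<Rightarrow> 's \<Rightarrow> 's pmf \<Rightarrow> 'a \<Rightarrow> 's \<Rightarrow> real)
      \<Rightarrow> (nat \<Rightarrow> 's \<Rightarrow> 's pmf \<Rightarrow> 'a \<Rightarrow> real) \<Rightarrow> ('s \<Rightarrow> 's pmf \<Rightarrow> real) \<Rightarrow> 's pmf
      \<Rightarrow> (nat \<Rightarrow> (nat \<Rightarrow> 's) \<Rightarrow> 'a measure) \<Rightarrow> 's \<Rightarrow> (nat \<Rightarrow> (nat \<Rightarrow> 's) \<Rightarrow> 'a measure) \<Rightarrow> real" where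
  "J T q F G \<mu> \<gamma> x \<gamma>' =
     measure_pmf.expectation (path_law T q (flow T q \<mu> \<gamma>) (return_pmf x) \<gamma>' T)
       (\<lambda>X. G (X T) (flow T q \<mu> \<gamma> T)
            + (\<Sum>s<T. LINT a|\<gamma>' s X. F s (X s) (flow T q \<mu> \<gamma> s) a))"

definition relaxed_MFE where
  "relaxed_MFE T A q F G \<mu> \<gamma>s \<longleftrightarrow> \<gamma>s \<in> relax_controls T A \<and>
     (\<forall>x. J T q F G \<mu> \<gamma>s x \<gamma>s = (INF \<gamma>\<in>relax_controls T A. J T q F G \<mu> \<gamma>s x \<gamma>))"

definition state_relaxed_MFE where
  "state_relaxed_MFE T A q F G \<mu> \<gamma>s \<longleftrightarrow> \<gamma>s \<in> state_relax_controls T A \<and>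
     (\<forall>x. J T q F G \<mu> \<gamma>s x \<gamma>s = (INF \<gamma>\<in>state_relax_controls T A. J T q F G \<mu> \<gamma>s x \<gamma>))"

definition relaxed_raw_set_value where
  "relaxed_raw_set_value T A q F G \<mu> =
     {(\<lambda>x. J T q F G \<mu> \<gamma>s x \<gamma>s) | \<gamma>s. relaxed_MFE T A q F G \<mu> \<gamma>s}"

definition state_relaxed_raw_set_value where
  "state_relaxed_raw_set_value T A q F G \<mu> =
     {(\<lambda>x. J T q F G \<mu> \<gamma>s x \<gamma>s) | \<gamma>s. state_relaxed_MFE T A q F G \<mu> \<gamma>s}"


lemma stop_stop: "stop T s (stop T t x) = stop T (min s t) x"
  by (auto simp: stop_def fun_eq_iff min_def)

lemma stop_in_paths: "stop T t x \<in> paths T"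
  by (auto simp: stop_def paths_def)

lemma set_path_law: "X \<in> set_pmf (path_law T q \<nu> \<mu> \<gamma> s) \<Longrightarrow> X = stop T s X \<and> X \<in> paths T"
proof (cases s)
  case 0
  assume "X \<in> set_pmf (path_law T q \<nu> \<mu> \<gamma> s)"
  then obtain z where "X = stop T 0 z" using 0 by auto
  then show ?thesis using 0 by (simp add: stop_stop stop_in_paths)
next
  case (Suc n)
  assume "X \<in> set_pmf (path_law T q \<nu> \<mu> \<gamma> s)"
  then obtain z where "X = stop T s z" using Suc by (auto simp: step_def)
  then show ?thesis by (simp add: stop_stop stop_in_paths)
qed

lemma stop_upd: "stop T s (X(Suc s := y)) = stop T s X"
  by (auto simp: stop_def fun_eq_iff min_def)

lemma map_stop_path_law_Suc:
  "map_pmf (stop T s) (path_law T q \<nu> \<mu> \<gamma> (Suc s)) = path_law T q \<nu> \<mu> \<gamma> s"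
proof -
  have "map_pmf (stop T s) (path_law T q \<nu> \<mu> \<gamma> (Suc s))
      = bind_pmf (path_law T q \<nu> \<mu> \<gamma> s) (\<lambda>X. return_pmf (stop T s X))"
    by (simp add: step_def map_bind_pmf map_pmf_comp stop_stop stop_upd map_pmf_const)
  also have "\<dots> = map_pmf (stop T s) (path_law T q \<nu> \<mu> \<gamma> s)"
    by (simp add: map_pmf_def)
  also have "\<dots> = map_pmf id (path_law T q \<nu> \<mu> \<gamma> s)"
    by (rule map_pmf_cong) (use set_path_law in fastforce)+
  finally show ?thesis by simp
qed

lemma map_stop_path_law:
  "s \<le> n \<Longrightarrow> map_pmf (stop T s) (path_law T q \<nu> \<mu> \<gamma> n) = path_law T q \<nu> \<mu> \<gamma> s"
proof (induction n rule: dec_induct)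
  case base
  have "map_pmf (stop T s) (path_law T q \<nu> \<mu> \<gamma> s) = map_pmf id (path_law T q \<nu> \<mu> \<gamma> s)"
    by (rule map_pmf_cong) (use set_path_law in fastforce)+
  then show ?case by simp
next
  case (step n)
  have "map_pmf (stop T s) (path_law T q \<nu> \<mu> \<gamma> (Suc n))
      = map_pmf (stop T s) (map_pmf (stop T n) (path_law T q \<nu> \<mu> \<gamma> (Suc n)))"
    using step.hyps by (simp only: map_pmf_comp stop_stop) simp
  then show ?case using step.IH by (simp only: map_stop_path_law_Suc)
qed

lemma marginal_path_law:
  assumes "s \<le> n" "n \<le> T"
  shows "map_pmf (\<lambda>X. X s) (path_law T q \<nu> \<mu> \<gamma> n) = map_pmf (\<lambda>X. X s) (path_law T q \<nu> \<mu> \<gamma> s)"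
proof -
  have "map_pmf (\<lambda>X. X s) (path_law T q \<nu> \<mu> \<gamma> s)
      = map_pmf (\<lambda>X. X s) (map_pmf (stop T s) (path_law T q \<nu> \<mu> \<gamma> n))"
    using assms by (simp only: map_stop_path_law)
  also have "\<dots> = map_pmf (\<lambda>X. X s) (path_law T q \<nu> \<mu> \<gamma> n)"
    using assms by (simp add: map_pmf_comp stop_def)
  finally show ?thesis by simp
qed

lemma path_law_cong:
  assumes "\<And>r. r < s \<Longrightarrow> \<nu> r = \<nu>' r"
  shows "path_law T q \<nu> \<mu> \<gamma> s = path_law T q \<nu>' \<mu> \<gamma> s"
  using assms by (induction s) auto

lemma mf_path_law_eq:
  assumes "s \<le> T"
  shows "mf_path_law T q \<mu> \<gamma> s = path_law T q (flow T q \<mu> \<gamma>) \<mu> \<gamma> s"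
proof -
  define \<nu> where "\<nu> s = map_pmf (\<lambda>X. X s) (mf_path_law T q \<mu> \<gamma> s)" for s
  have *: "mf_path_law T q \<mu> \<gamma> s = path_law T q \<nu> \<mu> \<gamma> s" for s
    by (induction s) (auto simp: \<nu>_def)
  have "flow T q \<mu> \<gamma> r = \<nu> r" if "r \<le> T" for r
    using marginal_path_law[OF that order_refl, of q \<nu> \<mu> \<gamma>] by (simp add: flow_def \<nu>_def *)
  then have "path_law T q (flow T q \<mu> \<gamma>) \<mu> \<gamma> s = path_law T q \<nu> \<mu> \<gamma> s"
    using assms by (intro path_law_cong) auto
  then show ?thesis using * by simp
qed

lemma agree_iff_stop:
  assumes "s \<le> T"
  shows "X \<in> agree s x \<longleftrightarrow> stop T s X = stop T s x"
proof
  assume "stop T s X = stop T s x"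
  then have "stop T s X r = stop T s x r" for r by simp
  then show "X \<in> agree s x" using assms
    by (force simp: agree_def stop_def min_def split: if_splits)
qed (auto simp: agree_def stop_def)

lemma prob_agree:
  assumes "s \<le> n" "n \<le> T"
  shows "measure_pmf.prob (path_law T q \<nu> \<mu> \<gamma> n) (agree s x) = pmf (path_law T q \<nu> \<mu> \<gamma> s) (stop T s x)"
proof -
  have "agree s x = stop T s -` {stop T s x}"
    using assms agree_iff_stop[of s T _ x] by auto
  then show ?thesis
    using assms map_stop_path_law[of s n T q \<nu> \<mu> \<gamma>, symmetric] by (simp add: pmf_map)
qed

lemma pmf_trans_pmf:
  fixes q :: "nat \<Rightarrow> 's::finite \<Rightarrow> 's pmf \<Rightarrow> 'a::topological_space \<Rightarrow> 's \<Rightarrow> real"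
  assumes "\<eta> \<in> relaxed_actions A"
    and "\<And>y. (\<lambda>a. q s x \<nu> a y) \<in> borel_measurable (restrict_space borel A)"
    and "\<And>a y. a \<in> A \<Longrightarrow> 0 \<le> q s x \<nu> a y"
    and "\<And>a. a \<in> A \<Longrightarrow> (\<Sum>y\<in>UNIV. q s x \<nu> a y) = 1"
  shows "pmf (trans_pmf q s x \<nu> \<eta>) y = (LINT a|\<eta>. q s x \<nu> a y)"
proof -
  have p: "prob_space \<eta>" and sets: "sets \<eta> = sets (restrict_space borel A)"
    using assms(1) by (auto simp: relaxed_actions_def space_prob_algebra)
  interpret prob_space \<eta> by (rule p)
  have sp: "space \<eta> = A" using sets_eq_imp_space_eq[OF sets] by (simp add: space_restrict_space)
  have m: "(\<lambda>a. q s x \<nu> a y) \<in> borel_measurable \<eta>" for y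
    using assms(2) sets measurable_cong_sets by blast
  have le1: "q s x \<nu> a y \<le> 1" if "a \<in> A" for a y
    using member_le_sum[of y UNIV "q s x \<nu> a"] assms(3,4) that by auto
  have i: "integrable \<eta> (\<lambda>a. q s x \<nu> a y)" for y
    by (rule integrable_const_bound[where B = 1]) (use m assms(3) le1 sp in \<open>auto intro!: AE_I2\<close>)
  have nn: "0 \<le> (LINT a|\<eta>. q s x \<nu> a y)" for y
    by (rule integral_nonneg_AE) (use assms(3) sp in \<open>auto intro!: AE_I2\<close>)
  have "(\<Sum>y\<in>UNIV. LINT a|\<eta>. q s x \<nu> a y) = (LINT a|\<eta>. (\<Sum>y\<in>UNIV. q s x \<nu> a y))"
    using i by simp
  also have "\<dots> = (LINT a|\<eta>. 1)"
    by (rule Bochner_Integration.integral_cong) (use assms(4) sp in auto)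
  also have "\<dots> = 1" using prob_space by simp
  finally show ?thesis unfolding trans_pmf_def
    using nn by (intro pmf_embed_pmf) (auto simp: nn_integral_count_space_finite sum_ennreal)
qed

lemma path_law_step:
  assumes "s < T" "x \<in> paths T" "\<gamma> s x = \<gamma> s (stop T s x)"
  shows "pmf (path_law T q \<nu> \<mu> \<gamma> (Suc s)) (stop T (Suc s) (x(Suc s := y)))
       = pmf (path_law T q \<nu> \<mu> \<gamma> s) (stop T s x) * pmf (trans_pmf q s (x s) (\<nu> s) (\<gamma> s x)) y"
proof -
  let ?P = "path_law T q \<nu> \<mu> \<gamma> s"
  let ?z = "stop T (Suc s) (x(Suc s := y))"
  let ?K = "\<lambda>X. trans_pmf q s (X s) (\<nu> s) (\<gamma> s X)"
  let ?f = "\<lambda>X y. stop T (Suc s) (X(Suc s := y))"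
  have eq: "?f X y' = ?z \<longleftrightarrow> X = stop T s x \<and> y' = y" if "X = stop T s X" for X y'
  proof
    assume a: "?f X y' = ?z"
    from a have "?f X y' (Suc s) = ?z (Suc s)" by simp
    then have "y' = y" using assms(1) by (simp add: stop_def)
    moreover have "stop T s (?f X y') = stop T s ?z" using a by simp
    then have "stop T s X = stop T s x" by (simp add: stop_stop stop_upd)
    ultimately show "X = stop T s x \<and> y' = y" using that by simp
  next
    assume "X = stop T s x \<and> y' = y"
    then show "?f X y' = ?z" by (auto simp: stop_def fun_eq_iff min_def)
  qed
  have "pmf (path_law T q \<nu> \<mu> \<gamma> (Suc s)) ?z = (LINT X|?P. pmf (map_pmf (?f X) (?K X)) ?z)"
    by (simp add: step_def pmf_bind)
  also have "\<dots> = (LINT X|?P. indicat_real {stop T s x} X * pmf (?K (stop T s x)) y)"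
  proof (rule integral_cong_AE)
    show "AE X in ?P. pmf (map_pmf (?f X) (?K X)) ?z
        = indicat_real {stop T s x} X * pmf (?K (stop T s x)) y"
    proof (rule AE_pmfI)
      fix X assume "X \<in> set_pmf ?P"
      then have X: "X = stop T s X" using set_path_law by blast
      have "pmf (map_pmf (?f X) (?K X)) ?z = measure_pmf.prob (?K X) {y'. ?f X y' = ?z}"
        by (simp add: pmf_map vimage_def)
      also have "{y'. ?f X y' = ?z} = (if X = stop T s x then {y} else {})"
        using eq[OF X] by auto
      also have "measure_pmf.prob (?K X) \<dots> = indicat_real {stop T s x} X * pmf (?K (stop T s x)) y"
        by (auto simp: measure_pmf_single)
      finally show "pmf (map_pmf (?f X) (?K X)) ?z
        = indicat_real {stop T s x} X * pmf (?K (stop T s x)) y" .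
    qed
  qed auto
  also have "\<dots> = pmf ?P (stop T s x) * pmf (?K (stop T s x)) y"
    by (simp add: measure_pmf_single)
  also have "stop T s x s = x s" using assms(1) by (simp add: stop_def)
  finally show ?thesis unfolding assms(3)[symmetric] .
qed

theorem path_law_cond:
  fixes q :: "nat \<Rightarrow> 's::finite \<Rightarrow> 's pmf \<Rightarrow> 'a::topological_space \<Rightarrow> 's \<Rightarrow> real"
    and \<nu> :: "nat \<Rightarrow> 's pmf" and \<mu> :: "'s pmf"
  assumes \<gamma>: "\<gamma> \<in> relax_controls T A"
    and q: "\<And>t x \<nu> y. t \<le> T \<Longrightarrow> (\<lambda>a. q t x \<nu> a y) \<in> borel_measurable (restrict_space borel A)"
    "\<And>t x \<nu> a y. t \<le> T \<Longrightarrow> a \<in> A \<Longrightarrow> 0 \<le> q t x \<nu> a y"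
    "\<And>t x \<nu> a. t \<le> T \<Longrightarrow> a \<in> A \<Longrightarrow> (\<Sum>y\<in>UNIV. q t x \<nu> a y) = 1"
  defines "P \<equiv> path_law T q \<nu> \<mu> \<gamma> T"
  shows "set_pmf P \<subseteq> paths T"
    and "map_pmf (\<lambda>X. X 0) P = \<mu>"
    and "\<And>s x y. s < T \<Longrightarrow> x \<in> paths T \<Longrightarrow>
      measure_pmf.prob P (agree s x \<inter> {X. X (Suc s) = y})
        = measure_pmf.prob P (agree s x) * (LINT a|\<gamma> s x. q s (x s) (\<nu> s) a y)"
proof -
  show "set_pmf P \<subseteq> paths T"
    unfolding P_def using set_path_law by blast
  show "map_pmf (\<lambda>X. X 0) P = \<mu>"
    unfolding P_def by (subst marginal_path_law) (simp_all add: map_pmf_comp stop_def)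
  fix s :: nat and x :: "nat \<Rightarrow> 's" and y :: 's
  assume s: "s < T" and x: "x \<in> paths T"
  have g: "\<gamma> s x \<in> relaxed_actions A" "\<gamma> s x = \<gamma> s (stop T s x)"
    using \<gamma> less_imp_le[OF s] x unfolding relax_controls_def by blast+
  have "agree s x \<inter> {X. X (Suc s) = y} = agree (Suc s) (x(Suc s := y))"
    by (auto simp: agree_def le_Suc_eq)
  then have "measure_pmf.prob P (agree s x \<inter> {X. X (Suc s) = y})
      = pmf (path_law T q \<nu> \<mu> \<gamma> (Suc s)) (stop T (Suc s) (x(Suc s := y)))"
    using prob_agree[of "Suc s" T T q \<nu> \<mu> \<gamma>] s by (simp add: P_def del: path_law.simps)
  also have "\<dots> = pmf (path_law T q \<nu> \<mu> \<gamma> s) (stop T s x) * pmf (trans_pmf q s (x s) (\<nu> s) (\<gamma> s x)) y"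
    by (rule path_law_step[where \<gamma> = \<gamma>, OF s x g(2)])
  also have "pmf (path_law T q \<nu> \<mu> \<gamma> s) (stop T s x) = measure_pmf.prob P (agree s x)"
    using prob_agree[of s T T q \<nu> \<mu> \<gamma> x] s by (simp add: P_def)
  also have "pmf (trans_pmf q s (x s) (\<nu> s) (\<gamma> s x)) y = (LINT a|\<gamma> s x. q s (x s) (\<nu> s) a y)"
    using s by (intro pmf_trans_pmf[OF g(1)] q) auto
  finally show "measure_pmf.prob P (agree s x \<inter> {X. X (Suc s) = y})
        = measure_pmf.prob P (agree s x) * (LINT a|\<gamma> s x. q s (x s) (\<nu> s) a y)" .
qed

theorem mf_path_law_cond:
  fixes q :: "nat \<Rightarrow> 's::finite \<Rightarrow> 's pmf \<Rightarrow> 'a::topological_space \<Rightarrow> 's \<Rightarrow> real"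
    and \<mu> :: "'s pmf"
  assumes \<gamma>: "\<gamma> \<in> relax_controls T A"
    and q: "\<And>t x \<nu> y. t \<le> T \<Longrightarrow> (\<lambda>a. q t x \<nu> a y) \<in> borel_measurable (restrict_space borel A)"
    "\<And>t x \<nu> a y. t \<le> T \<Longrightarrow> a \<in> A \<Longrightarrow> 0 \<le> q t x \<nu> a y"
    "\<And>t x \<nu> a. t \<le> T \<Longrightarrow> a \<in> A \<Longrightarrow> (\<Sum>y\<in>UNIV. q t x \<nu> a y) = 1"
  defines "P \<equiv> mf_path_law T q \<mu> \<gamma> T"
  shows "set_pmf P \<subseteq> paths T"
    and "map_pmf (\<lambda>X. X 0) P = \<mu>"
    and "\<And>s x y. s < T \<Longrightarrow> x \<in> paths T \<Longrightarrow>
      measure_pmf.prob P (agree s x \<inter> {X. X (Suc s) = y})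
        = measure_pmf.prob P (agree s x)
            * (LINT a|\<gamma> s x. q s (x s) (map_pmf (\<lambda>X. X s) P) a y)"
  using path_law_cond[OF \<gamma> q, where \<nu> = "flow T q \<mu> \<gamma>" and \<mu> = \<mu>]
  by (simp_all add: P_def mf_path_law_eq flow_def[symmetric])
    (simp_all add: flow_def mf_path_law_eq)

end

theory Submission
  imports Defs
begin

text \<open>
  Fix the flow of population measures. By dynamic programming, the optimal cost from \<open>x\<close> is the same
  over state dependent and over path dependent controls, and the cost of a control exceeds it by
  the expected sum of the nonnegative Bellman gaps along the path. Hence a state dependent
  equilibrium is an equilibrium among path dependent controls too. Conversely, given a path dependent
  equilibrium, replace the control at time \<open>t\<close> and state \<open>x\<close> by its conditional mean given
  \<open>X t = x\<close> under the population law. This preserves the marginal laws, hence the flow and the cost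
  averaged over \<open>\<mu>\<close>. As no cost is below the optimum and \<open>\<mu>\<close> has full support, the new control is
  optimal from every \<open>x\<close>.
\<close>

section \<open>Expectations, disintegration and infima\<close>

lemma expectation_bind_pmf_finite:
  fixes h :: "'b \<Rightarrow> real"
  assumes "finite (set_pmf p)" "\<And>x. x \<in> set_pmf p \<Longrightarrow> finite (set_pmf (f x))"
  shows "measure_pmf.expectation (bind_pmf p f) h
    = measure_pmf.expectation p (\<lambda>x. measure_pmf.expectation (f x) h)"
  using assms
  by (subst pmf_expectation_bind[where A = "set_pmf p"])
    (auto simp: integral_measure_pmf[where A = "set_pmf p"])

lemma expectation_cong_pmf:
  assumes "\<And>x. x \<in> set_pmf p \<Longrightarrow> f x = g x"
  shows "measure_pmf.expectation p f = measure_pmf.expectation p (g :: _ \<Rightarrow> real)"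
  using assms by (intro integral_cong_AE) (auto simp: AE_measure_pmf_iff)

text \<open>Law of total probability: the value of \<open>f\<close> is drawn first, then the point
  from the conditional law on its fibre. It later undoes the conditioning on the current
  state.\<close>

lemma bind_cond_pmf_fibre:
  "bind_pmf (map_pmf f p) (\<lambda>x. cond_pmf p {y. f y = x}) = p"
  by (rule bind_cond_pmf_cancel) (auto simp: vimage_def intro!: arg_cong[where f = "measure _"])

text \<open>Approximate attainment suffices, which matters because an optimal action need not exist
  in \<open>A\<close>.\<close>

lemma cINF_eqI:
  fixes f :: "'a \<Rightarrow> real"
  assumes "\<And>x. x \<in> S \<Longrightarrow> v \<le> f x" "\<And>e. 0 < e \<Longrightarrow> \<exists>x\<in>S. f x \<le> v + e"
  shows "(INF x\<in>S. f x) = v"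
proof (rule antisym)
  have ne: "S \<noteq> {}" using assms(2)[of 1] by auto
  then show "v \<le> (INF x\<in>S. f x)" using assms(1) by (rule cINF_greatest)
  show "(INF x\<in>S. f x) \<le> v"
  proof (rule field_le_epsilon)
    fix e :: real assume "0 < e"
    then obtain x where x: "x \<in> S" "f x \<le> v + e" using assms(2) by blast
    have "bdd_below (f ` S)" using assms(1) by (rule bdd_belowI2)
    with x show "(INF x\<in>S. f x) \<le> v + e" by (meson cINF_lower order_trans)
  qed
qed

section \<open>Path laws, costs and population flows\<close>

lemma finite_set_path_law:
  fixes \<mu> :: "'s::finite pmf"
  shows "finite (set_pmf (path_law T q \<nu> \<mu> \<gamma> s))"
  by (induction s) (auto simp: step_def)

text \<open>With the flow held fixed, each step is a bind over the previous law, so the path law is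
  linear in the initial law.\<close>

lemma path_law_bind:
  "path_law T q \<nu> (bind_pmf \<mu> f) \<gamma> s = bind_pmf \<mu> (\<lambda>x. path_law T q \<nu> (f x) \<gamma> s)"
  by (induction s) (auto simp: step_def map_bind_pmf bind_assoc_pmf)

lemma stop_upto_id: "x \<in> paths T \<Longrightarrow> stop T T x = x"
  by (auto simp: stop_def paths_def fun_eq_iff min_def PiE_def extensional_def)

text \<open>The flow \<open>\<nu>\<close> is not tied to a population control as it is in
  \<open>J\<close>, so controls can be exchanged while it stays frozen. The initial law is arbitrary
  so that costs can be averaged over \<mu>.\<close>

definition cost where
  "cost T q F G \<nu> \<mu> \<gamma> = measure_pmf.expectation (path_law T q \<nu> \<mu> \<gamma> T)
     (\<lambda>X. G (X T) (\<nu> T) + (\<Sum>s<T. LINT a|\<gamma> s X. F s (X s) (\<nu> s) a))"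

lemma J_eq_cost: "J T q F G \<mu> \<gamma> x \<gamma>' = cost T q F G (flow T q \<mu> \<gamma>) (return_pmf x) \<gamma>'"
  by (simp add: J_def cost_def)

lemma cost_cong_flow:
  assumes "\<And>s. s \<le> T \<Longrightarrow> \<nu> s = \<nu>' s"
  shows "cost T q F G \<nu> \<mu> \<gamma> = cost T q F G \<nu>' \<mu> \<gamma>"
proof -
  have "path_law T q \<nu> \<mu> \<gamma> T = path_law T q \<nu>' \<mu> \<gamma> T"
    using assms by (intro path_law_cong) auto
  then show ?thesis using assms by (simp add: cost_def)
qed

lemma cost_average:
  fixes \<mu> :: "'s::finite pmf"
  shows "cost T q F G \<nu> \<mu> \<gamma> = (\<Sum>x\<in>UNIV. pmf \<mu> x * cost T q F G \<nu> (return_pmf x) \<gamma>)"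
proof -
  have "path_law T q \<nu> \<mu> \<gamma> T = bind_pmf \<mu> (\<lambda>x. path_law T q \<nu> (return_pmf x) \<gamma> T)"
    using path_law_bind[of T q \<nu> \<mu> return_pmf \<gamma> T] by (simp add: bind_return_pmf')
  then show ?thesis
    by (simp add: cost_def expectation_bind_pmf_finite finite_set_path_law
        integral_measure_pmf[where A = UNIV])
qed

text \<open>A flow that reproduces itself as the marginals of the law it drives is the population
  flow: each mean field step reads only the current marginal, so the two recursions coincide by
  induction on time.\<close>

lemma flow_eqI:
  assumes "\<And>s. s \<le> T \<Longrightarrow> \<nu> s = map_pmf (\<lambda>X. X s) (path_law T q \<nu> \<mu> \<gamma> s)" "s \<le> T"
  shows "flow T q \<mu> \<gamma> s = \<nu> s"
proof -
  have "mf_path_law T q \<mu> \<gamma> n = path_law T q \<nu> \<mu> \<gamma> n" if "n \<le> T" for n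
    using that
  proof (induction n)
    case (Suc n)
    then show ?case using assms(1)[of n, symmetric] by simp
  qed simp
  then show ?thesis
    using assms(2) marginal_path_law[of s T T q \<nu> \<mu> \<gamma>]
    by (simp add: flow_def assms(1)[OF assms(2), symmetric])
qed

lemma flow_eq_marginal:
  assumes "s \<le> T"
  shows "flow T q \<mu> \<gamma> s = map_pmf (\<lambda>X. X s) (path_law T q (flow T q \<mu> \<gamma>) \<mu> \<gamma> s)"
  unfolding marginal_path_law[OF assms order_refl, symmetric] mf_path_law_eq[OF order_refl, symmetric]
  by (rule flow_def)

lemma marginal_step:
  assumes "s < T"
  shows "map_pmf (\<lambda>X. X (Suc s)) (path_law T q \<nu> \<mu> \<gamma> (Suc s))
    = bind_pmf (path_law T q \<nu> \<mu> \<gamma> s) (\<lambda>X. trans_pmf q s (X s) (\<nu> s) (\<gamma> s X))"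
  using assms by (simp add: step_def map_bind_pmf map_pmf_comp stop_def)

section \<open>Dynamic programming for a frozen flow\<close>

locale mfg_data =
  fixes T :: nat
    and A :: "'a::topological_space set"
    and q :: "nat \<Rightarrow> 's::finite \<Rightarrow> 's pmf \<Rightarrow> 'a \<Rightarrow> 's \<Rightarrow> real"
    and F :: "nat \<Rightarrow> 's \<Rightarrow> 's pmf \<Rightarrow> 'a \<Rightarrow> real"
    and G :: "'s \<Rightarrow> 's pmf \<Rightarrow> real"
    and C :: real
  assumes q_measurable:
      "t \<le> T \<Longrightarrow> (\<lambda>a. q t x \<nu> a y) \<in> borel_measurable (restrict_space borel A)"
    and q_nonneg: "t \<le> T \<Longrightarrow> a \<in> A \<Longrightarrow> 0 \<le> q t x \<nu> a y"
    and q_sum: "t \<le> T \<Longrightarrow> a \<in> A \<Longrightarrow> (\<Sum>y\<in>UNIV. q t x \<nu> a y) = 1"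
    and F_measurable:
      "t \<le> T \<Longrightarrow> (\<lambda>a. F t x \<nu> a) \<in> borel_measurable (restrict_space borel A)"
    and F_bounded: "t \<le> T \<Longrightarrow> a \<in> A \<Longrightarrow> \<bar>F t x \<nu> a\<bar> \<le> C"
begin

text \<open>Recursion on the number of steps left makes the backward Bellman equation primitive
  recursive; with \<open>Suc k\<close> steps left the time is \<open>T - Suc k\<close>.\<close>

primrec value_to_go :: "(nat \<Rightarrow> 's pmf) \<Rightarrow> nat \<Rightarrow> 's \<Rightarrow> real" where
  "value_to_go \<nu> 0 = (\<lambda>x. G x (\<nu> T))"
| "value_to_go \<nu> (Suc k) = (\<lambda>x. INF a\<in>A. F (T - Suc k) x (\<nu> (T - Suc k)) a
      + (\<Sum>y\<in>UNIV. q (T - Suc k) x (\<nu> (T - Suc k)) a y * value_to_go \<nu> k y))"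

definition opt_value :: "(nat \<Rightarrow> 's pmf) \<Rightarrow> nat \<Rightarrow> 's \<Rightarrow> real" where
  "opt_value \<nu> t = value_to_go \<nu> (T - t)"

text \<open>The Bellman residual: the loss from playing \<open>a\<close> for one step at time
  \<open>t\<close> in state \<open>x\<close> when the continuation is optimal.\<close>

definition gap :: "(nat \<Rightarrow> 's pmf) \<Rightarrow> nat \<Rightarrow> 's \<Rightarrow> 'a \<Rightarrow> real" where
  "gap \<nu> t x a = F t x (\<nu> t) a + (\<Sum>y\<in>UNIV. q t x (\<nu> t) a y * opt_value \<nu> (Suc t) y)
     - opt_value \<nu> t x"

lemma opt_value_terminal: "opt_value \<nu> T x = G x (\<nu> T)"
  by (simp add: opt_value_def)

lemma opt_value_step:
  assumes "t < T"
  shows "opt_value \<nu> t x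
    = (INF a\<in>A. F t x (\<nu> t) a + (\<Sum>y\<in>UNIV. q t x (\<nu> t) a y * opt_value \<nu> (Suc t) y))"
proof -
  have "T - t = Suc (T - Suc t)" "T - Suc (T - Suc t) = t" using assms by auto
  then show ?thesis by (simp add: opt_value_def)
qed

lemma q_le_1: "t \<le> T \<Longrightarrow> a \<in> A \<Longrightarrow> q t x \<nu> a y \<le> 1"
  using member_le_sum[of y UNIV "q t x \<nu> a"] q_nonneg q_sum by auto

lemma stage_cost_bounded:
  assumes "t \<le> T" "a \<in> A"
  shows "\<bar>F t x \<nu> a + (\<Sum>y\<in>UNIV. q t x \<nu> a y * w y)\<bar> \<le> C + (\<Sum>y\<in>UNIV. \<bar>w y\<bar>)"
proof -
  have "\<bar>\<Sum>y\<in>UNIV. q t x \<nu> a y * w y\<bar> \<le> (\<Sum>y\<in>UNIV. \<bar>q t x \<nu> a y * w y\<bar>)"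
    by (rule sum_abs)
  also have "\<dots> \<le> (\<Sum>y\<in>UNIV. \<bar>w y\<bar>)"
    using assms by (intro sum_mono) (auto simp: abs_mult q_nonneg q_le_1 intro: mult_left_le_one_le)
  finally show ?thesis using F_bounded[OF assms, of x \<nu>] by linarith
qed

lemma gap_bounded:
  assumes "t \<le> T"
  obtains B where "\<And>a. a \<in> A \<Longrightarrow> \<bar>gap \<nu> t x a\<bar> \<le> B"
proof
  fix a assume "a \<in> A"
  then show "\<bar>gap \<nu> t x a\<bar> \<le> C + (\<Sum>y\<in>UNIV. \<bar>opt_value \<nu> (Suc t) y\<bar>) + \<bar>opt_value \<nu> t x\<bar>"
    using stage_cost_bounded[OF assms, of a x "\<nu> t" "opt_value \<nu> (Suc t)"]
    unfolding gap_def by linarith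
qed

text \<open>A real infimum lies below the members of a set that is bounded below;
  \<open>stage_cost_bounded\<close> supplies the bound.\<close>

lemma gap_nonneg:
  assumes "t < T" "a \<in> A"
  shows "0 \<le> gap \<nu> t x a"
proof -
  have "bdd_below ((\<lambda>a. F t x (\<nu> t) a + (\<Sum>y\<in>UNIV. q t x (\<nu> t) a y * opt_value \<nu> (Suc t) y)) ` A)"
    using stage_cost_bounded[of t _ x "\<nu> t" "opt_value \<nu> (Suc t)"] assms(1)
    by (intro bdd_belowI2[where m = "- (C + (\<Sum>y\<in>UNIV. \<bar>opt_value \<nu> (Suc t) y\<bar>))"]) force
  then show ?thesis
    using assms(2) by (auto simp: gap_def opt_value_step[OF assms(1)] intro: cINF_lower)
qed

lemma gap_small:
  assumes "t < T" "A \<noteq> {}" "0 < e"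
  obtains a where "a \<in> A" "gap \<nu> t x a < e"
proof -
  let ?h = "\<lambda>a. F t x (\<nu> t) a + (\<Sum>y\<in>UNIV. q t x (\<nu> t) a y * opt_value \<nu> (Suc t) y)"
  have "(INF a\<in>A. ?h a) < opt_value \<nu> t x + e"
    using assms by (simp add: opt_value_step)
  then obtain a where "a \<in> A" "?h a < opt_value \<nu> t x + e"
    using cInf_lessD[of "?h ` A"] assms(2) by blast
  then show ?thesis using that by (auto simp: gap_def)
qed

lemma gap_measurable:
  "t \<le> T \<Longrightarrow> gap \<nu> t x \<in> borel_measurable (restrict_space borel A)"
  unfolding gap_def using q_measurable F_measurable by measurable

section \<open>Integrals against relaxed actions\<close>

lemma relaxed_actionD:
  assumes "\<eta> \<in> relaxed_actions A"
  shows "prob_space \<eta>" "sets \<eta> = sets (restrict_space borel A)" "space \<eta> = A"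
proof -
  show "prob_space \<eta>" and s: "sets \<eta> = sets (restrict_space borel A)"
    using assms by (auto simp: relaxed_actions_def space_prob_algebra)
  show "space \<eta> = A" using sets_eq_imp_space_eq[OF s] by (simp add: space_restrict_space)
qed

lemma integrable_relaxed_action:
  fixes f :: "'a \<Rightarrow> real"
  assumes "\<eta> \<in> relaxed_actions A" "f \<in> borel_measurable (restrict_space borel A)"
    "\<And>a. a \<in> A \<Longrightarrow> \<bar>f a\<bar> \<le> B"
  shows "integrable \<eta> f"
proof -
  note \<eta> = relaxed_actionD[OF assms(1)]
  interpret prob_space \<eta> by (rule \<eta>(1))
  have "f \<in> borel_measurable \<eta>" using assms(2) \<eta>(2) measurable_cong_sets by blast
  then show ?thesis
    by (intro integrable_const_bound[where B = B]) (use assms(3) \<eta>(3) in \<open>auto intro!: AE_I2\<close>)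
qed

lemma expectation_trans_pmf:
  fixes h :: "'s \<Rightarrow> real"
  assumes "\<eta> \<in> relaxed_actions A" "t \<le> T"
  shows "measure_pmf.expectation (trans_pmf q t x \<nu> \<eta>) h
    = (\<Sum>y\<in>UNIV. (LINT a|\<eta>. q t x \<nu> a y) * h y)"
  using assms
  by (simp add: integral_measure_pmf[where A = UNIV]
      pmf_trans_pmf[OF assms(1) q_measurable q_nonneg q_sum])

lemma integral_gap:
  assumes "\<eta> \<in> relaxed_actions A" "t \<le> T"
  shows "(LINT a|\<eta>. gap \<nu> t x a) = (LINT a|\<eta>. F t x (\<nu> t) a)
    + measure_pmf.expectation (trans_pmf q t x (\<nu> t) \<eta>) (opt_value \<nu> (Suc t)) - opt_value \<nu> t x"
proof -
  interpret prob_space \<eta> by (rule relaxed_actionD[OF assms(1)])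
  have iF: "integrable \<eta> (\<lambda>a. F t x (\<nu> t) a)"
    using assms F_measurable F_bounded by (intro integrable_relaxed_action[where B = C])
  have iq: "integrable \<eta> (\<lambda>a. q t x (\<nu> t) a y)" for y
    using assms q_measurable q_nonneg q_le_1 by (intro integrable_relaxed_action[where B = 1]) auto
  show ?thesis
    using iF iq assms by (simp add: gap_def expectation_trans_pmf prob_space)
qed

section \<open>Cost decomposition and near-optimal controls\<close>

lemma relax_controlD:
  assumes "\<gamma> \<in> relax_controls T A" "t \<le> T" "X \<in> paths T"
  shows "\<gamma> t X \<in> relaxed_actions A" "\<gamma> t X = \<gamma> t (stop T t X)"
  using assms unfolding relax_controls_def by blast+

text \<open>The optimal value at the current state plus the running cost so far has an expected
  increment equal to the expected gap. Summing these increments up to \<open>T\<close>, where the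
  optimal value is the terminal cost, gives the identity.\<close>

lemma cost_eq_value_plus_gaps:
  assumes \<gamma>: "\<gamma> \<in> relax_controls T A"
  shows "cost T q F G \<nu> \<mu> \<gamma> = measure_pmf.expectation \<mu> (opt_value \<nu> 0)
    + (\<Sum>s<T. measure_pmf.expectation (path_law T q \<nu> \<mu> \<gamma> s)
        (\<lambda>X. LINT a|\<gamma> s X. gap \<nu> s (X s) a))"
proof -
  define c where "c s X = (LINT a|\<gamma> s X. F s (X s) (\<nu> s) a)" for s X
  let ?P = "path_law T q \<nu> \<mu> \<gamma>"
  have "measure_pmf.expectation (?P n) (\<lambda>X. opt_value \<nu> n (X n) + (\<Sum>s<n. c s X))
      = measure_pmf.expectation \<mu> (opt_value \<nu> 0)
    + (\<Sum>s<n. measure_pmf.expectation (?P s) (\<lambda>X. LINT a|\<gamma> s X. gap \<nu> s (X s) a))"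
    if "n \<le> T" for n
    using that
  proof (induction n)
    case 0
    then show ?case by (simp add: stop_def)
  next
    case (Suc n)
    let ?h = "\<lambda>X. opt_value \<nu> (Suc n) (X (Suc n)) + (\<Sum>s<Suc n. c s X)"
    let ?K = "\<lambda>X. trans_pmf q n (X n) (\<nu> n) (\<gamma> n X)"
    have fin: "integrable (?P n) f" for f :: "_ \<Rightarrow> real"
      by (rule integrable_measure_pmf_finite[OF finite_set_path_law])
    \<comment> \<open>Controls are adapted, so the state appended at time \<open>Suc n\<close>
      leaves the costs incurred up to time \<open>n\<close> unchanged.\<close>
    have c_adapted: "c s (stop T (Suc n) (X(Suc n := y))) = c s X"
      if "X \<in> paths T" "s \<le> n" for s X y
    proof -
      let ?X = "stop T (Suc n) (X(Suc n := y))"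
      have "stop T s ?X = stop T s X"
        using that(2) by (auto simp: stop_def fun_eq_iff min_def)
      then have "\<gamma> s ?X = \<gamma> s X"
        using relax_controlD(2)[OF \<gamma>, of s] that Suc.prems stop_in_paths
        by (metis Suc_leD le_trans)
      moreover have "?X s = X s" using that(2) Suc.prems by (auto simp: stop_def)
      ultimately show ?thesis by (simp add: c_def)
    qed
    have "measure_pmf.expectation (?P (Suc n)) ?h
        = measure_pmf.expectation (?P n) (\<lambda>X. measure_pmf.expectation (?K X)
            (\<lambda>y. ?h (stop T (Suc n) (X(Suc n := y)))))"
      by (simp add: step_def expectation_bind_pmf_finite finite_set_path_law)
    also have "\<dots> = measure_pmf.expectation (?P n) (\<lambda>X.
        (opt_value \<nu> n (X n) + (\<Sum>s<n. c s X)) + (LINT a|\<gamma> n X. gap \<nu> n (X n) a))"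
    proof (rule expectation_cong_pmf)
      fix X assume "X \<in> set_pmf (?P n)"
      then have X: "X \<in> paths T" using set_path_law by blast
      have "measure_pmf.expectation (?K X) (\<lambda>y. ?h (stop T (Suc n) (X(Suc n := y))))
          = measure_pmf.expectation (?K X) (\<lambda>y. opt_value \<nu> (Suc n) y + (\<Sum>s<Suc n. c s X))"
        using Suc.prems c_adapted[OF X]
        by (intro expectation_cong_pmf arg_cong2[where f = "(+)"] sum.cong) (auto simp: stop_def)
      also have "\<dots> = measure_pmf.expectation (?K X) (opt_value \<nu> (Suc n)) + (\<Sum>s<Suc n. c s X)"
        by (simp add: integrable_measure_pmf_finite)
      finally show "measure_pmf.expectation (?K X) (\<lambda>y. ?h (stop T (Suc n) (X(Suc n := y))))
          = (opt_value \<nu> n (X n) + (\<Sum>s<n. c s X)) + (LINT a|\<gamma> n X. gap \<nu> n (X n) a)"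
        using integral_gap[OF relax_controlD(1)[OF \<gamma> _ X], of n n \<nu> "X n"] Suc.prems
        by (simp add: c_def)
    qed
    finally show ?case using Suc fin by simp
  qed
  from this[of T] show ?thesis by (simp add: cost_def c_def opt_value_terminal)
qed

text \<open>Each \<open>\<gamma> s X\<close> lives on \<open>A\<close>, where all gaps are
  nonnegative, so the gap terms of the decomposition can only raise the cost.\<close>

lemma value_le_cost:
  assumes "\<gamma> \<in> relax_controls T A"
  shows "opt_value \<nu> 0 x \<le> cost T q F G \<nu> (return_pmf x) \<gamma>"
proof -
  have "0 \<le> measure_pmf.expectation (path_law T q \<nu> (return_pmf x) \<gamma> s)
        (\<lambda>X. LINT a|\<gamma> s X. gap \<nu> s (X s) a)" if "s < T" for s
  proof (rule integral_nonneg_AE, rule AE_pmfI)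
    fix X assume "X \<in> set_pmf (path_law T q \<nu> (return_pmf x) \<gamma> s)"
    then have "X \<in> paths T" using set_path_law by blast
    then have "space (\<gamma> s X) = A"
      using relaxed_actionD(3) relax_controlD(1)[OF assms] that by (metis less_imp_le)
    then show "0 \<le> (LINT a|\<gamma> s X. gap \<nu> s (X s) a)"
      using gap_nonneg[OF that] by (intro integral_nonneg_AE AE_I2) auto
  qed
  then show ?thesis by (auto simp: cost_eq_value_plus_gaps[OF assms] intro: sum_nonneg)
qed

text \<open>Playing at each time and state a single action of small gap is state dependent, and the
  small gaps add up to at most \<open>e\<close>.\<close>

lemma near_optimal_state_control:
  assumes "A \<noteq> {}" "0 < e"
  shows "\<exists>\<gamma>\<in>state_relax_controls T A. \<forall>x.
    cost T q F G \<nu> (return_pmf x) \<gamma> \<le> opt_value \<nu> 0 x + e"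
proof -
  \<comment> \<open>The divisor \<open>T + 1\<close> stays positive for
    \<open>T = 0\<close>.\<close>
  define e' where "e' = e / (T + 1)"
  have e': "0 < e'" using assms by (simp add: e'_def)
  \<comment> \<open>The implication makes the choice total: at time \<open>T\<close>, where a
    control must still take a value, any action serves.\<close>
  have "\<exists>a\<in>A. t < T \<longrightarrow> gap \<nu> t x a < e'" for t x
    using gap_small[OF _ assms(1) e'] assms(1) by (metis ex_in_conv)
  then obtain b where b: "\<And>t x. b t x \<in> A" "\<And>t x. t < T \<Longrightarrow> gap \<nu> t x (b t x) < e'"
    by metis
  define \<gamma> where "\<gamma> t X = return (restrict_space borel A) (b t (X t))" for t and X :: "nat \<Rightarrow> 's"
  have \<gamma>: "\<gamma> \<in> relax_controls T A"
    using b(1) by (auto simp: relax_controls_def relaxed_actions_def \<gamma>_def space_prob_algebra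
        stop_def space_restrict_space intro!: prob_space_return)
  then have state: "\<gamma> \<in> state_relax_controls T A"
    by (auto simp: state_relax_controls_def \<gamma>_def
        intro!: exI[of _ "\<lambda>t x. return (restrict_space borel A) (b t x)"])
  have "(LINT a|\<gamma> s X. gap \<nu> s (X s) a) \<le> e'" if "s < T" for s X
    using b gap_measurable[of s \<nu> "X s"] that
    by (simp add: \<gamma>_def integral_return space_restrict_space less_imp_le)
  then have "measure_pmf.expectation (path_law T q \<nu> (return_pmf x) \<gamma> s)
        (\<lambda>X. LINT a|\<gamma> s X. gap \<nu> s (X s) a) \<le> e'" if "s < T" for s x
    using that by (intro measure_pmf.integral_le_const integrable_measure_pmf_finite
        finite_set_path_law) auto
  then have "cost T q F G \<nu> (return_pmf x) \<gamma> \<le> opt_value \<nu> 0 x + (\<Sum>s<T. e')" for x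
    unfolding cost_eq_value_plus_gaps[OF \<gamma>] by (intro add_mono sum_mono) auto
  moreover have "(\<Sum>s<T. e') \<le> e" using assms(2) by (simp add: e'_def field_simps)
  ultimately show ?thesis using state by (meson add_left_mono order_trans)
qed

section \<open>Equilibria as attainment of the optimal value\<close>

lemma actions_nonempty: "\<gamma> \<in> relax_controls T A \<Longrightarrow> A \<noteq> {}"
  using relax_controlD(1)[of \<gamma> 0 "stop T 0 undefined"] relaxed_actionD prob_space.not_empty
  by (metis le0 stop_in_paths)

lemma state_relax_controls_subset: "state_relax_controls T A \<subseteq> relax_controls T A"
  by (auto simp: state_relax_controls_def)

text \<open>The lower bound holds for all path dependent controls, while near-optimal controls exist
  already among the state dependent ones. Hence every class \<open>S\<close> in between has the same
  infimum.\<close>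

lemma INF_cost_eq_value:
  assumes "A \<noteq> {}" "state_relax_controls T A \<subseteq> S" "S \<subseteq> relax_controls T A"
  shows "(INF \<gamma>\<in>S. cost T q F G \<nu> (return_pmf x) \<gamma>) = opt_value \<nu> 0 x"
  using assms value_le_cost near_optimal_state_control[OF assms(1)]
  by (intro cINF_eqI) (blast, meson subsetD)

text \<open>An admissible control forces \<open>A\<close> to be nonempty, so the infimum is the
  optimal value. The state dependent notion gets the same equation below, which leaves the
  admissible class as the only difference.\<close>

lemma relaxed_MFE_iff:
  "relaxed_MFE T A q F G \<mu> \<gamma> \<longleftrightarrow> \<gamma> \<in> relax_controls T A \<and>
    (\<forall>x. J T q F G \<mu> \<gamma> x \<gamma> = opt_value (flow T q \<mu> \<gamma>) 0 x)"
proof (cases "\<gamma> \<in> relax_controls T A")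
  case True
  show ?thesis
    unfolding relaxed_MFE_def J_eq_cost
      INF_cost_eq_value[OF actions_nonempty[OF True] state_relax_controls_subset order_refl] ..
qed (simp add: relaxed_MFE_def)

lemma state_relaxed_MFE_iff:
  "state_relaxed_MFE T A q F G \<mu> \<gamma> \<longleftrightarrow> \<gamma> \<in> state_relax_controls T A \<and>
    (\<forall>x. J T q F G \<mu> \<gamma> x \<gamma> = opt_value (flow T q \<mu> \<gamma>) 0 x)"
proof (cases "\<gamma> \<in> state_relax_controls T A")
  case True
  then have "\<gamma> \<in> relax_controls T A" using state_relax_controls_subset by blast
  show ?thesis
    unfolding state_relaxed_MFE_def J_eq_cost
      INF_cost_eq_value[OF actions_nonempty[OF \<open>\<gamma> \<in> relax_controls T A\<close>] order_refl
        state_relax_controls_subset] ..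
qed (simp add: state_relaxed_MFE_def)

section \<open>Averaging a control over the past given the current state\<close>

text \<open>
  Off the support of the law of \<open>X t\<close> the conditional law is an arbitrary probability measure.
  Stopping the path at \<open>T\<close> brings every function into the path space, so that the kernel is
  a relaxed action everywhere.
\<close>

definition cond_control ::
    "(nat \<Rightarrow> (nat \<Rightarrow> 's) pmf) \<Rightarrow> (nat \<Rightarrow> (nat \<Rightarrow> 's) \<Rightarrow> 'a measure) \<Rightarrow> nat \<Rightarrow> 's \<Rightarrow> 'a measure" where
  "cond_control P \<gamma> t x =
     measure_pmf (cond_pmf (P t) {X. X t = x}) \<bind> (\<lambda>X. \<gamma> t (stop T T X))"

text \<open>Every map out of a discrete space is measurable, so it suffices that all values are
  relaxed actions.\<close>

lemma stopped_kernel: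
  assumes "\<gamma> \<in> relax_controls T A" "t \<le> T"
  shows "(\<lambda>X. \<gamma> t (stop T T X)) \<in> count_space UNIV \<rightarrow>\<^sub>M prob_algebra (restrict_space borel A)"
  using relax_controlD(1)[OF assms stop_in_paths] by (auto simp: relaxed_actions_def)

lemma cond_control_relaxed:
  assumes "\<gamma> \<in> relax_controls T A" "t \<le> T"
  shows "cond_control P \<gamma> t x \<in> relaxed_actions A"
proof -
  have p: "measure_pmf (cond_pmf (P t) {X. X t = x}) \<in> space (prob_algebra (count_space UNIV))"
    by (auto simp: space_prob_algebra intro: measure_pmf.prob_space_axioms)
  show ?thesis
    using prob_space_bind'[OF p stopped_kernel[OF assms]] sets_bind'[OF p stopped_kernel[OF assms]]
    by (simp add: cond_control_def relaxed_actions_def space_prob_algebra)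
qed

text \<open>Integration against a mixture of measures is iterated integration. As \<open>x\<close>
  has positive mass, the conditional law charges only paths of \<open>P t\<close>, on which stopping
  at \<open>T\<close> is the identity.\<close>

lemma integral_cond_control:
  fixes f :: "'a \<Rightarrow> real"
  assumes "\<gamma> \<in> relax_controls T A" "t \<le> T" "set_pmf (P t) \<subseteq> paths T"
    "x \<in> set_pmf (map_pmf (\<lambda>X. X t) (P t))"
    "f \<in> borel_measurable (restrict_space borel A)" "\<And>a. a \<in> A \<Longrightarrow> \<bar>f a\<bar> \<le> B"
  shows "(LINT a|cond_control P \<gamma> t x. f a)
    = measure_pmf.expectation (cond_pmf (P t) {X. X t = x}) (\<lambda>X. LINT a|\<gamma> t X. f a)"
proof -
  let ?p = "cond_pmf (P t) {X. X t = x}"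
  have ne: "set_pmf (P t) \<inter> {X. X t = x} \<noteq> {}" using assms(4) by auto
  have "(LINT a|cond_control P \<gamma> t x. f a)
      = measure_pmf.expectation ?p (\<lambda>X. LINT a|\<gamma> t (stop T T X). f a)"
    unfolding cond_control_def
  proof (rule integral_bind[where K = "restrict_space borel A" and B' = 1])
    show "(\<lambda>X. \<gamma> t (stop T T X)) \<in> measure_pmf ?p \<rightarrow>\<^sub>M subprob_algebra (restrict_space borel A)"
      using measurable_prob_algebraD[OF stopped_kernel[OF assms(1,2)]] by simp
    show "AE X in ?p. emeasure (\<gamma> t (stop T T X)) (space (\<gamma> t (stop T T X))) \<le> ennreal 1"
      using relaxed_actionD(1)[OF relax_controlD(1)[OF assms(1,2) stop_in_paths]]
      by (simp add: prob_space.emeasure_space_1)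
  qed (use assms(5,6) in \<open>auto simp: space_restrict_space
        intro: measure_pmf.finite_measure_axioms\<close>)
  also have "\<dots> = measure_pmf.expectation ?p (\<lambda>X. LINT a|\<gamma> t X. f a)"
    using assms(3) set_cond_pmf[OF ne] by (intro expectation_cong_pmf) (auto simp: stop_upto_id)
  finally show ?thesis .
qed

text \<open>Transition probabilities are linear in the relaxed action, so averaging the actions over
  a fibre averages the transitions.\<close>

lemma trans_pmf_cond_control:
  assumes \<gamma>: "\<gamma> \<in> relax_controls T A" and t: "t \<le> T" and P: "set_pmf (P t) \<subseteq> paths T"
    and x: "x \<in> set_pmf (map_pmf (\<lambda>X. X t) (P t))"
  shows "trans_pmf q t x \<nu> (cond_control P \<gamma> t x)
    = bind_pmf (cond_pmf (P t) {X. X t = x}) (\<lambda>X. trans_pmf q t (X t) \<nu> (\<gamma> t X))"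
proof (rule pmf_eqI)
  fix y
  let ?p = "cond_pmf (P t) {X. X t = x}"
  note pmf_trans = pmf_trans_pmf[where q = q and s = t, OF _ q_measurable[OF t] q_nonneg[OF t] q_sum[OF t]]
  have ne: "set_pmf (P t) \<inter> {X. X t = x} \<noteq> {}" using x by auto
  have "pmf (trans_pmf q t x \<nu> (cond_control P \<gamma> t x)) y
      = measure_pmf.expectation ?p (\<lambda>X. LINT a|\<gamma> t X. q t x \<nu> a y)"
    using q_nonneg[OF t] q_le_1[OF t] cond_control_relaxed[OF \<gamma> t]
    by (simp add: pmf_trans)
      (intro integral_cond_control[where B = 1] \<gamma> t P x q_measurable; simp)
  \<comment> \<open>On the fibre \<open>X t = x\<close> the fixed state \<open>x\<close> may be
    replaced by \<open>X t\<close>.\<close>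
  also have "\<dots> = measure_pmf.expectation ?p (\<lambda>X. pmf (trans_pmf q t (X t) \<nu> (\<gamma> t X)) y)"
    using P set_cond_pmf[OF ne] relax_controlD(1)[OF \<gamma> t]
    by (intro expectation_cong_pmf) (auto simp: pmf_trans subset_iff)
  finally show "pmf (trans_pmf q t x \<nu> (cond_control P \<gamma> t x)) y
      = pmf (bind_pmf ?p (\<lambda>X. trans_pmf q t (X t) \<nu> (\<gamma> t X))) y"
    by (simp add: pmf_bind)
qed

text \<open>The law of the whole path may change; only its marginals at single times are matched.
  They suffice, because the decomposition of the cost involves at each time only the marginal and
  the mean action given the current state.\<close>

lemma state_control_from_path_control:
  assumes \<gamma>: "\<gamma> \<in> relax_controls T A"
  shows "\<exists>\<gamma>'\<in>state_relax_controls T A. (\<forall>s\<le>T. flow T q \<mu> \<gamma>' s = flow T q \<mu> \<gamma> s) \<and>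
    cost T q F G (flow T q \<mu> \<gamma>) \<mu> \<gamma>' = cost T q F G (flow T q \<mu> \<gamma>) \<mu> \<gamma>"
proof -
  define \<nu> where "\<nu> = flow T q \<mu> \<gamma>"
  define P where "P = path_law T q \<nu> \<mu> \<gamma>"
  define \<gamma>' where "\<gamma>' t X = cond_control P \<gamma> t (X t)" for t and X :: "nat \<Rightarrow> 's"
  define P' where "P' = path_law T q \<nu> \<mu> \<gamma>'"
  have \<gamma>': "\<gamma>' \<in> relax_controls T A"
    using cond_control_relaxed[OF \<gamma>] by (auto simp: relax_controls_def \<gamma>'_def stop_def)
  then have state: "\<gamma>' \<in> state_relax_controls T A"
    by (auto simp: state_relax_controls_def \<gamma>'_def)
  have P_paths: "set_pmf (P s) \<subseteq> paths T" for s using set_path_law by (fastforce simp: P_def)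
  have marg: "map_pmf (\<lambda>X. X s) (P' s) = map_pmf (\<lambda>X. X s) (P s)" if "s \<le> T" for s
    using that
  proof (induction s)
    case 0
    then show ?case by (simp add: P_def P'_def)
  next
    case (Suc s)
    then have s: "s < T" "s \<le> T" by auto
    let ?K = "\<lambda>X. trans_pmf q s (X s) (\<nu> s) (\<gamma> s X)"
    let ?m = "map_pmf (\<lambda>X. X s) (P s)"
    have "map_pmf (\<lambda>X. X (Suc s)) (P' (Suc s))
        = bind_pmf (map_pmf (\<lambda>X. X s) (P' s)) (\<lambda>x. trans_pmf q s x (\<nu> s) (cond_control P \<gamma> s x))"
      unfolding P'_def marginal_step[OF s(1)] by (simp add: \<gamma>'_def bind_map_pmf)
    also have "\<dots> = bind_pmf ?m (\<lambda>x. trans_pmf q s x (\<nu> s) (cond_control P \<gamma> s x))"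
      using Suc.IH[OF s(2)] by simp
    \<comment> \<open>The congruence asks only for states in the support of \<open>?m\<close>, where
      the conditional law is genuine.\<close>
    also have "\<dots> = bind_pmf ?m (\<lambda>x. bind_pmf (cond_pmf (P s) {X. X s = x}) ?K)"
      by (intro bind_pmf_cong refl trans_pmf_cond_control \<gamma> s P_paths)
    also have "\<dots> = bind_pmf (P s) ?K"
      by (simp only: bind_assoc_pmf[symmetric] bind_cond_pmf_fibre)
    finally show ?case unfolding P_def marginal_step[OF s(1)] .
  qed
  \<comment> \<open>The same disintegration as for the marginals, with the integrated gap in place
    of the transition.\<close>
  have gaps: "measure_pmf.expectation (P' s) (\<lambda>X. LINT a|\<gamma>' s X. gap \<nu> s (X s) a)
      = measure_pmf.expectation (P s) (\<lambda>X. LINT a|\<gamma> s X. gap \<nu> s (X s) a)"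
    (is "?lhs = ?rhs") if "s < T" for s
  proof -
    have s: "s \<le> T" using that by simp
    let ?m = "map_pmf (\<lambda>X. X s) (P s)"
    let ?c = "\<lambda>x. cond_pmf (P s) {X. X s = x}"
    have ne: "set_pmf (P s) \<inter> {X. X s = x} \<noteq> {}" if "x \<in> set_pmf ?m" for x using that by auto
    have "?lhs = measure_pmf.expectation (map_pmf (\<lambda>X. X s) (P' s))
        (\<lambda>x. LINT a|cond_control P \<gamma> s x. gap \<nu> s x a)"
      by (simp add: \<gamma>'_def)
    also have "\<dots> = measure_pmf.expectation ?m (\<lambda>x. LINT a|cond_control P \<gamma> s x. gap \<nu> s x a)"
      by (simp only: marg[OF s])
    also have "\<dots> = measure_pmf.expectation ?m (\<lambda>x. measure_pmf.expectation (?c x)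
        (\<lambda>X. LINT a|\<gamma> s X. gap \<nu> s (X s) a))"
    proof (rule expectation_cong_pmf)
      fix x assume x: "x \<in> set_pmf ?m"
      obtain B where B: "\<And>a. a \<in> A \<Longrightarrow> \<bar>gap \<nu> s x a\<bar> \<le> B" using gap_bounded[OF s] by blast
      have "(LINT a|cond_control P \<gamma> s x. gap \<nu> s x a)
          = measure_pmf.expectation (?c x) (\<lambda>X. LINT a|\<gamma> s X. gap \<nu> s x a)"
        by (rule integral_cond_control[where P = P, OF \<gamma> s P_paths x gap_measurable[OF s] B])
      also have "\<dots> = measure_pmf.expectation (?c x) (\<lambda>X. LINT a|\<gamma> s X. gap \<nu> s (X s) a)"
        using set_cond_pmf[OF ne[OF x]] by (intro expectation_cong_pmf) auto
      finally show "(LINT a|cond_control P \<gamma> s x. gap \<nu> s x a)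
          = measure_pmf.expectation (?c x) (\<lambda>X. LINT a|\<gamma> s X. gap \<nu> s (X s) a)" .
    qed
    also have "\<dots> = measure_pmf.expectation (bind_pmf ?m ?c) (\<lambda>X. LINT a|\<gamma> s X. gap \<nu> s (X s) a)"
      using set_cond_pmf[OF ne] finite_set_path_law[of T q \<nu> \<mu> \<gamma> s]
      by (intro expectation_bind_pmf_finite[symmetric]) (auto simp: P_def)
    also have "\<dots> = ?rhs" by (simp only: bind_cond_pmf_fibre)
    finally show ?thesis .
  qed
  \<comment> \<open>The old flow is therefore consistent with the new control as well, and
    \<open>flow_eqI\<close> identifies it as the flow generated by \<open>\<gamma>'\<close>.\<close>
  have "\<nu> s = map_pmf (\<lambda>X. X s) (P' s)" if "s \<le> T" for s
    using flow_eq_marginal[OF that, of q \<mu> \<gamma>] marg[OF that] by (simp add: \<nu>_def P_def)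
  then have "\<forall>s\<le>T. flow T q \<mu> \<gamma>' s = \<nu> s" unfolding P'_def by (blast intro: flow_eqI)
  moreover have "cost T q F G \<nu> \<mu> \<gamma>' = cost T q F G \<nu> \<mu> \<gamma>"
    using gaps by (simp add: cost_eq_value_plus_gaps[OF \<gamma>] cost_eq_value_plus_gaps[OF \<gamma>']
        P_def P'_def)
  ultimately show ?thesis using state by (auto simp: \<nu>_def)
qed

section \<open>Transfer of equilibria between the two classes\<close>

lemma opt_value_cong:
  assumes "\<And>s. s \<le> T \<Longrightarrow> \<nu> s = \<nu>' s"
  shows "opt_value \<nu> t = opt_value \<nu>' t"
proof -
  have "value_to_go \<nu> k = value_to_go \<nu>' k" for k
    by (induction k) (simp_all add: assms)
  then show ?thesis by (simp add: opt_value_def)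
qed

lemma state_MFE_from_relaxed_MFE:
  assumes "relaxed_MFE T A q F G \<mu> \<gamma>" "\<mu> \<in> full_support"
  shows "\<exists>\<gamma>'. state_relaxed_MFE T A q F G \<mu> \<gamma>' \<and>
    (\<forall>x. J T q F G \<mu> \<gamma>' x \<gamma>' = J T q F G \<mu> \<gamma> x \<gamma>)"
proof -
  let ?\<nu> = "flow T q \<mu> \<gamma>"
  let ?c = "\<lambda>\<gamma> x. cost T q F G ?\<nu> (return_pmf x) \<gamma>"
  have \<gamma>: "\<gamma> \<in> relax_controls T A" and opt: "?c \<gamma> x = opt_value ?\<nu> 0 x" for x
    using assms(1) by (auto simp: relaxed_MFE_iff J_eq_cost)
  obtain \<gamma>' where \<gamma>': "\<gamma>' \<in> state_relax_controls T A"
    and flow: "\<And>s. s \<le> T \<Longrightarrow> flow T q \<mu> \<gamma>' s = ?\<nu> s"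
    and cost: "cost T q F G ?\<nu> \<mu> \<gamma>' = cost T q F G ?\<nu> \<mu> \<gamma>"
    using state_control_from_path_control[OF \<gamma>] by blast
  have nonneg: "0 \<le> pmf \<mu> x * (?c \<gamma>' x - opt_value ?\<nu> 0 x)" for x
    using value_le_cost \<gamma>' state_relax_controls_subset by fastforce
  \<comment> \<open>Both averaged costs are split over starting points; by \<open>opt\<close> the
    one of \<open>\<gamma>\<close> is the average of the optimal value.\<close>
  have "(\<Sum>x\<in>UNIV. pmf \<mu> x * (?c \<gamma>' x - opt_value ?\<nu> 0 x)) = 0"
    using cost unfolding cost_average[of _ _ _ _ _ \<mu>] opt
    by (simp add: right_diff_distrib sum_subtractf)
  then have "pmf \<mu> x * (?c \<gamma>' x - opt_value ?\<nu> 0 x) = 0" for x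
    using nonneg by (simp add: sum_nonneg_eq_0_iff)
  \<comment> \<open>Full support turns vanishing of the weighted excess costs into optimality from
    every starting point.\<close>
  moreover have "pmf \<mu> x \<noteq> 0" for x
    using assms(2) by (simp add: full_support_def set_eq_iff set_pmf_iff)
  ultimately have "?c \<gamma>' x = opt_value ?\<nu> 0 x" for x
    by (metis eq_iff_diff_eq_0 mult_eq_0_iff)
  \<comment> \<open>So far the flow was that of \<open>\<gamma>\<close>; \<open>J\<close> uses the
    flow of \<open>\<gamma>'\<close>, which agrees with it up to time \<open>T\<close>.\<close>
  then have "J T q F G \<mu> \<gamma>' x \<gamma>' = opt_value ?\<nu> 0 x" for x
    by (simp add: J_eq_cost cost_cong_flow[OF flow])
  then show ?thesis
    using \<gamma>' opt by (auto simp: state_relaxed_MFE_iff opt_value_cong[OF flow] J_eq_cost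
        intro!: exI[of _ \<gamma>'])
qed

lemma relaxed_raw_set_values_eq:
  assumes "\<mu> \<in> full_support"
  shows "state_relaxed_raw_set_value T A q F G \<mu> = relaxed_raw_set_value T A q F G \<mu>"
proof (rule antisym)
  \<comment> \<open>Both notions demand the same equation for \<open>J\<close>, so inclusion of the
    control classes is enough here.\<close>
  show "state_relaxed_raw_set_value T A q F G \<mu> \<subseteq> relaxed_raw_set_value T A q F G \<mu>"
    using state_relax_controls_subset
    by (auto simp: state_relaxed_raw_set_value_def relaxed_raw_set_value_def
        state_relaxed_MFE_iff relaxed_MFE_iff)
  show "relaxed_raw_set_value T A q F G \<mu> \<subseteq> state_relaxed_raw_set_value T A q F G \<mu>"
    unfolding state_relaxed_raw_set_value_def relaxed_raw_set_value_def
    using state_MFE_from_relaxed_MFE[OF _ assms] by (auto, metis)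
qed

end

section \<open>Measurability from the continuity assumptions, and the theorem\<close>

lemma borel_measurable_modulus:
  fixes f :: "'a::metric_space \<Rightarrow> real" and \<rho> :: "real \<Rightarrow> real"
  assumes "\<And>a a'. a \<in> A \<Longrightarrow> a' \<in> A \<Longrightarrow> \<bar>f a - f a'\<bar> \<le> \<rho> (dist a a')"
    and "\<rho> 0 = 0" "continuous (at 0 within {0..}) \<rho>"
  shows "f \<in> borel_measurable (restrict_space borel A)"
proof (rule borel_measurable_continuous_on_restrict)
  show "continuous_on A f"
    unfolding continuous_on_iff
  proof (intro ballI allI impI)
    fix a e :: real and x assume "x \<in> A" "0 < e"
    then obtain d where d: "0 < d" "\<And>r. 0 \<le> r \<Longrightarrow> r < d \<Longrightarrow> \<bar>\<rho> r\<bar> < e"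
      using assms(2,3) by (force simp: continuous_within_eps_delta dist_real_def)
    have "dist (f y) (f x) < e" if "y \<in> A" "dist y x < d" for y
      using assms(1)[OF that(1) \<open>x \<in> A\<close>] d(2)[of "dist y x"] that by (simp add: dist_real_def)
    then show "\<exists>d>0. \<forall>y\<in>A. dist y x < d \<longrightarrow> dist (f y) (f x) < e" using d(1) by blast
  qed
qed

theorem theorem7p6:
  fixes T :: nat
    and A :: "(real ^ 'd0) set"
    and q :: "nat \<Rightarrow> 's::finite \<Rightarrow> 's pmf \<Rightarrow> real ^ 'd0 \<Rightarrow> 's \<Rightarrow> real"
    and F :: "nat \<Rightarrow> 's \<Rightarrow> 's pmf \<Rightarrow> real ^ 'd0 \<Rightarrow> real"
    and G :: "'s \<Rightarrow> 's pmf \<Rightarrow> real"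
    and c\<^sub>q L\<^sub>q C\<^sub>0 :: real
    and \<rho> :: "real \<Rightarrow> real"
    and \<mu> :: "'s pmf"
  assumes A_measurable: "A \<in> sets borel"
    and q_range: "\<And>t x \<nu> a y. t \<le> T \<Longrightarrow> a \<in> A \<Longrightarrow> 0 < q t x \<nu> a y \<and> q t x \<nu> a y < 1"
    and q_sum: "\<And>t x \<nu> a. t \<le> T \<Longrightarrow> a \<in> A \<Longrightarrow> (\<Sum>y\<in>UNIV. q t x \<nu> a y) = 1"
    and c\<^sub>q_pos: "c\<^sub>q > 0"
    and q_lower: "\<And>t x \<nu> a y. t \<le> T \<Longrightarrow> a \<in> A \<Longrightarrow> c\<^sub>q \<le> q t x \<nu> a y"
    and q_Lipschitz: "\<And>t x \<nu> \<nu>' a a' y. t \<le> T \<Longrightarrow> a \<in> A \<Longrightarrow> a' \<in> A \<Longrightarrow>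
          \<bar>q t x \<nu> a y - q t x \<nu>' a' y\<bar> \<le> L\<^sub>q * (W1 \<nu> \<nu>' + dist a a')"
    and F_bounded: "\<And>t x \<nu> a. t \<le> T \<Longrightarrow> a \<in> A \<Longrightarrow> \<bar>F t x \<nu> a\<bar> \<le> C\<^sub>0"
    and G_bounded: "\<And>x \<nu>. \<bar>G x \<nu>\<bar> \<le> C\<^sub>0"
    and \<rho>_modulus: "\<rho> 0 = 0" "continuous (at 0 within {0..}) \<rho>"
    and F_modulus: "\<And>t x \<nu> \<nu>' a a'. t \<le> T \<Longrightarrow> a \<in> A \<Longrightarrow> a' \<in> A \<Longrightarrow>
          \<bar>F t x \<nu> a - F t x \<nu>' a'\<bar> \<le> \<rho> (W1 \<nu> \<nu>' + dist a a')"
    and G_modulus: "\<And>x \<nu> \<nu>'. \<bar>G x \<nu> - G x \<nu>'\<bar> \<le> \<rho> (W1 \<nu> \<nu>')"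
    and \<mu>_full: "\<mu> \<in> full_support"
  shows "state_relaxed_raw_set_value T A q F G \<mu> = relaxed_raw_set_value T A q F G \<mu>"
proof -
  have W1: "W1 \<nu> \<nu> = 0" for \<nu> :: "'s pmf" by (simp add: W1_def)
  interpret mfg_data T A q F G C\<^sub>0
  proof
    fix t x \<nu> y assume t: "t \<le> T"
    show "(\<lambda>a. q t x \<nu> a y) \<in> borel_measurable (restrict_space borel A)"
      \<comment> \<open>With equal population measures the \<open>W1\<close> term vanishes, and the
        Lipschitz bound becomes the linear modulus \<open>L\<^sub>q * r\<close> in the
        action.\<close>
      using q_Lipschitz[OF t, of _ _ x \<nu> y \<nu>] W1
      by (intro borel_measurable_modulus[where \<rho> = "\<lambda>r. L\<^sub>q * r"]) (auto intro!: continuous_intros)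
    show "(\<lambda>a. F t x \<nu> a) \<in> borel_measurable (restrict_space borel A)"
      using F_modulus[OF t, of _ _ x \<nu> \<nu>] W1 \<rho>_modulus
      by (intro borel_measurable_modulus[where \<rho> = \<rho>]) auto
  qed (use q_range q_sum F_bounded in \<open>auto intro: less_imp_le\<close>)
  show ?thesis by (rule relaxed_raw_set_values_eq[OF \<mu>_full])
qed

end
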